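(* Suppose that $\mu$ is a singular cardinal, $\theta=\mathrm{cf}(\mu)$, and $\vec\mu=\langle\mu_i\mid i<\theta\rangle$ is an increasing sequence of regular cardinals converging to $\mu$. Suppose moreover that there is a $\theta$-covering matrix $\mathcal D=\langle D(i,\beta)\mid i<\theta,\beta<\mu^+\rangle$ for $\mu^+$ that respects $\vec\mu$ and such that $\mathsf{CP}(\mathcal D)$ holds. Then $\mathrm{cf}\left(\prod\vec\mu,<^*\right)=\mu^+$.
   Context: For regular $\theta<\lambda$, a $\theta$-covering matrix for $\lambda$ is $\langle D(i,\beta)\mid i<\theta,\beta<\lambda\rangle$ such that each $\langle D(i,\beta)\mid i<\theta\rangle$ is $\subseteq$-increasing with union $\beta$, and for all $\beta<\gamma<\lambda$ and $i<\theta$ there is $j<\theta$ with $D(i,\beta)\subseteq D(j,\gamma)$. $\mathcal D$ respects $\vec\mu$ if $|D(i,\beta)|<\mu_i$ for all $i<\theta$ and $\beta<\mu^+$. $\mathsf{CP}(\mathcal D)$: there is an unbounded $A\subseteq\mu^+$ such that for every $X\in[A]^\theta$ there are $\beta<\mu^+$ and $i<\theta$ with $X\subseteq D(i,\beta)$. $\prod\vec\mu=\prod_{i<\theta}\mu_i$, and for $f,g\in\prod\vec\mu$, $f<^*g$ means $|\{i<\theta\mid g(i)\le f(i)\}|<\theta$; $\mathrm{cf}(\prod\vec\mu,<^* )$ is the least size of a $<^*$-cofinal subset. *)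

theory Defs
  imports Main "HOL-Library.FuncSet"
begin

unbundle cardinal_syntax

text \<open>Cardinals are cardinal-order relations as in the library, considered up to order
  isomorphism. The ordinals below a well-order \<open>r\<close> are the elements of \<open>Field r\<close>;
  \<open>\<beta> \<in> Field r\<close>, viewed as the set of its predecessors, is \<open>underS r \<beta>\<close>.\<close>

text \<open>The library predicate \<open>regularCard\<close> presupposes an infinite cardinal order.\<close>

definition regular_cardinal :: "'a rel \<Rightarrow> bool" where
  "regular_cardinal r \<longleftrightarrow> Card_order r \<and> infinite (Field r) \<and> regularCard r"

definition singular_cardinal :: "'a rel \<Rightarrow> bool" where
  "singular_cardinal r \<longleftrightarrow> Card_order r \<and> infinite (Field r) \<and> \<not> regularCard r"

definition cofinal_in :: "'a set \<Rightarrow> ('a \<Rightarrow> 'a \<Rightarrow> bool) \<Rightarrow> 'a set \<Rightarrow> bool" where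
  "cofinal_in P lt K \<longleftrightarrow> K \<subseteq> P \<and> (\<forall>x\<in>P. \<exists>y\<in>K. lt x y)"

text \<open>\<open>\<kappa> = cf(P, lt)\<close>: \<open>\<kappa>\<close> is the least cardinality of a cofinal subset. Being a predicate
  of \<open>\<kappa>\<close>, it also asserts that a cofinal subset exists.\<close>

definition is_cf :: "'a set \<Rightarrow> ('a \<Rightarrow> 'a \<Rightarrow> bool) \<Rightarrow> 'k rel \<Rightarrow> bool" where
  "is_cf P lt \<kappa> \<longleftrightarrow> Card_order \<kappa> \<and>
     (\<exists>K. cofinal_in P lt K \<and> |K| =o \<kappa>) \<and>
     (\<forall>K. cofinal_in P lt K \<longrightarrow> \<kappa> \<le>o |K| )"

definition is_cf_of_cardinal :: "'a rel \<Rightarrow> 'k rel \<Rightarrow> bool" where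
  "is_cf_of_cardinal r \<kappa> \<longleftrightarrow> is_cf (Field r) (\<lambda>a b. a \<noteq> b \<and> (a, b) \<in> r) \<kappa>"

lemma cofinal_in_Field_iff_cofinal:
  "cofinal_in (Field r) (\<lambda>a b. a \<noteq> b \<and> (a, b) \<in> r) K \<longleftrightarrow> K \<subseteq> Field r \<and> cofinal K r"
  by (simp add: cofinal_in_def cofinal_def)

definition increasing_regular_seq :: "'t rel \<Rightarrow> ('t \<Rightarrow> 'a rel) \<Rightarrow> bool" where
  "increasing_regular_seq \<theta> m \<longleftrightarrow>
     (\<forall>i\<in>Field \<theta>. regular_cardinal (m i)) \<and>
     (\<forall>i j. (i, j) \<in> \<theta> \<and> i \<noteq> j \<longrightarrow> m i <o m j)"

text \<open>\<open>\<mu> = sup {m i | i < \<theta>}\<close>. For the least-upper-bound clause it suffices to let \<open>r\<close> range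
  over well-orders on the carrier type of \<open>\<mu>\<close>, since every ordinal below \<open>\<mu>\<close> has a copy there.\<close>

definition converges_to :: "'t rel \<Rightarrow> ('t \<Rightarrow> 'a rel) \<Rightarrow> 'a rel \<Rightarrow> bool" where
  "converges_to \<theta> m \<mu> \<longleftrightarrow>
     (\<forall>i\<in>Field \<theta>. m i \<le>o \<mu>) \<and>
     (\<forall>r :: 'a rel. Well_order r \<and> (\<forall>i\<in>Field \<theta>. m i \<le>o r) \<longrightarrow> \<mu> \<le>o r)"

text \<open>Here \<open>D i \<beta>\<close> is a set of ordinals below \<open>l\<close>, and only its values at \<open>i \<in> Field \<theta>\<close>,
  \<open>\<beta> \<in> Field l\<close> matter.\<close>

definition covering_matrix :: "'t rel \<Rightarrow> 'l rel \<Rightarrow> ('t \<Rightarrow> 'l \<Rightarrow> 'l set) \<Rightarrow> bool" where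
  "covering_matrix \<theta> l D \<longleftrightarrow>
     regular_cardinal \<theta> \<and> regular_cardinal l \<and> \<theta> <o l \<and>
     (\<forall>\<beta>\<in>Field l. relChain \<theta> (\<lambda>i. D i \<beta>) \<and> (\<Union>i\<in>Field \<theta>. D i \<beta>) = underS l \<beta>) \<and>
     (\<forall>\<beta> \<gamma>. (\<beta>, \<gamma>) \<in> l \<and> \<beta> \<noteq> \<gamma> \<longrightarrow>
        (\<forall>i\<in>Field \<theta>. \<exists>j\<in>Field \<theta>. D i \<beta> \<subseteq> D j \<gamma>))"

definition respects_seq ::
    "'t rel \<Rightarrow> 'l rel \<Rightarrow> ('t \<Rightarrow> 'l \<Rightarrow> 'l set) \<Rightarrow> ('t \<Rightarrow> 'a rel) \<Rightarrow> bool" where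
  "respects_seq \<theta> l D m \<longleftrightarrow> (\<forall>i\<in>Field \<theta>. \<forall>\<beta>\<in>Field l. |D i \<beta>| <o m i)"

definition CP :: "'t rel \<Rightarrow> 'l rel \<Rightarrow> ('t \<Rightarrow> 'l \<Rightarrow> 'l set) \<Rightarrow> bool" where
  "CP \<theta> l D \<longleftrightarrow>
     (\<exists>A. A \<subseteq> Field l \<and> cofinal A l \<and>
        (\<forall>X. X \<subseteq> A \<and> |X| =o \<theta> \<longrightarrow> (\<exists>\<beta>\<in>Field l. \<exists>i\<in>Field \<theta>. X \<subseteq> D i \<beta>)))"

text \<open>Functions in the product are extensional: they take the value \<open>undefined\<close> off \<open>Field \<theta>\<close>.\<close>

definition seq_prod :: "'t rel \<Rightarrow> ('t \<Rightarrow> 'a rel) \<Rightarrow> ('t \<Rightarrow> 'a) set" where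
  "seq_prod \<theta> m = (\<Pi>\<^sub>E i\<in>Field \<theta>. Field (m i))"

definition less_star :: "'t rel \<Rightarrow> ('t \<Rightarrow> 'a rel) \<Rightarrow> ('t \<Rightarrow> 'a) \<Rightarrow> ('t \<Rightarrow> 'a) \<Rightarrow> bool" where
  "less_star \<theta> m f g \<longleftrightarrow> |{i \<in> Field \<theta>. (g i, f i) \<in> m i}| <o \<theta>"

end

theory Submission
  imports Defs
begin

text \<open>Upper bound: let \<open>A\<close> witness \<open>CP\<close>, and fix injections of each \<open>\<mu>\<^sub>i\<close> into \<open>A\<close>. The values
  of a function \<open>f\<close> in the product become a subset of \<open>A\<close> of size at most \<open>\<theta>\<close>, hence lie in some
  \<open>D i \<beta>\<close>, and so in \<open>D j \<beta>\<close> for all \<open>j \<ge> i\<close>. As \<open>|D j \<beta>| < \<mu>\<^sub>j\<close>, the ordinals below \<open>\<mu>\<^sub>j\<close> coded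
  in \<open>D j \<beta>\<close> have a strict bound \<open>g\<^sub>\<beta> j\<close>, which exceeds \<open>f j\<close>. So the \<open>\<mu>\<^sup>+\<close> many functions
  \<open>g\<^sub>\<beta>\<close> are cofinal.

  Lower bound: a family of size at most \<open>\<mu>\<close> splits into pieces \<open>F\<^sub>j\<close> of size at most \<open>\<mu>\<^sub>j\<close>. Once
  \<open>\<theta> < \<mu>\<^sub>i\<close>, regularity gives a bound \<open>g i < \<mu>\<^sub>i\<close> for the values at \<open>i\<close> of all members of
  \<open>F\<^sub>j\<close> with \<open>j < i\<close>. No member of the family lies above \<open>g\<close>.\<close>

section \<open>Strict bounds, initial segments and tails in cardinal orders\<close>

text \<open>A set smaller than a regular cardinal is not cofinal, so some \<open>a\<close> has no
  element of \<open>S\<close> strictly above it. Any \<open>b\<close> beyond \<open>a\<close> then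
  makes the bound strict.\<close>

lemma regular_cardinal_strict_bound:
  assumes "regular_cardinal r" "S \<subseteq> Field r" "|S| <o r"
  shows "\<exists>b\<in>Field r. \<forall>x\<in>S. (x, b) \<in> r \<and> x \<noteq> b"
proof -
  have co: "Card_order r" and inf: "infinite (Field r)" and reg: "regularCard r"
    using assms(1) by (auto simp: regular_cardinal_def)
  have wo: "Well_order r" using co by (simp add: card_order_on_well_order_on)
  have "\<not> cofinal S r"
    using reg assms not_ordLess_ordIso unfolding regularCard_def by blast
  then obtain a where a: "a \<in> Field r" "\<And>x. x \<in> S \<Longrightarrow> \<not> (a \<noteq> x \<and> (a, x) \<in> r)"
    unfolding cofinal_def by blast
  obtain b where b: "b \<in> Field r" "a \<noteq> b" "(a, b) \<in> r"
    using infinite_Card_order_limit[OF co inf a(1)] by blast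
  have lin: "Linear_order r" using wo by (simp add: well_order_on_def)
  have "(x, b) \<in> r \<and> x \<noteq> b" if "x \<in> S" for x
  proof -
    have xa: "(x, a) \<in> r"
      using a that assms(2) lin
      by (metis in_mono linear_order_on_def partial_order_on_def preorder_on_def refl_onD total_on_def)
    have "(x, b) \<in> r"
      using xa b(3) lin unfolding order_on_defs by (meson transD)
    moreover have "x \<noteq> b"
      using xa b(2,3) lin unfolding order_on_defs by (meson antisymD)
    ultimately show ?thesis by blast
  qed
  then show ?thesis using b(1) by blast
qed

lemma under_ordLess:
  assumes "Card_order r" "infinite (Field r)"
  shows "|under r k| <o r"
proof (cases "k \<in> Field r")
  case True
  obtain k' where k': "k' \<in> Field r" "k \<noteq> k'" "(k, k') \<in> r"
    using infinite_Card_order_limit[OF assms True] by blast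
  have "under r k \<subseteq> underS r k'"
    using k' assms(1) card_order_on_well_order_on[OF assms(1)]
    unfolding under_def underS_def order_on_defs
    by (auto dest: transD antisymD)
  then show ?thesis
    using card_of_mono1 card_of_underS[OF assms(1) k'(1)] ordLeq_ordLess_trans by blast
next
  case False
  then have "under r k = {}" by (auto simp: under_def Field_def)
  then show ?thesis
    using assms card_of_Field_ordIso[OF assms(1)] finite_ordLess_infinite[of "|{}|" r]
      card_of_Well_order card_order_on_well_order_on by (metis Field_card_of finite.emptyI)
qed

text \<open>Otherwise the field of an infinite cardinal would be covered by two smaller sets, an
  initial segment and \<open>Y\<close>. This refutes \<open>less_star\<close> once the exceptional
  indices contain a tail.\<close>

lemma not_ordLess_if_cobounded:
  assumes "Card_order r" "infinite (Field r)" "Field r - under r k \<subseteq> Y"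
  shows "\<not> |Y| <o r"
proof
  assume "|Y| <o r"
  then have "|under r k \<union> Y| <o r"
    using card_of_Un_ordLess_infinite_Field[OF assms(2,1) under_ordLess[OF assms(1,2)]] by blast
  moreover have "r \<le>o |under r k \<union> Y|"
    using assms(3) card_of_Field_ordIso[OF assms(1)] card_of_mono1[of "Field r" "under r k \<union> Y"]
    by (meson Diff_subset_conv ordIso_ordLeq_trans ordIso_symmetric)
  ultimately show False by (meson not_ordLess_ordLeq)
qed

lemma not_under_iff:
  assumes "Well_order r" "j \<in> Field r" "i \<in> Field r"
  shows "i \<notin> under r j \<longleftrightarrow> (j, i) \<in> r \<and> j \<noteq> i"
proof -
  have "(j, j) \<in> r" "antisym r" "j \<noteq> i \<Longrightarrow> (i, j) \<in> r \<or> (j, i) \<in> r"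
    using assms unfolding order_on_defs by (auto simp: refl_on_def total_on_def)
  then show ?thesis by (auto simp: under_def dest: antisymD)
qed

section \<open>The lower bound for the cofinality\<close>

text \<open>The supremum clause of \<open>converges_to\<close> compares \<open>\<mu>\<close> only
  with well-orders on its own carrier type. A sum smaller than \<open>\<mu>\<close> is therefore
  copied into \<open>Field \<mu>\<close>, where its cardinality bounds every \<open>m i\<close> and
  so contradicts leastness.\<close>

lemma converges_to_ordLeq_Sigma:
  fixes \<mu> :: "'a rel"
  assumes "Card_order \<mu>" "converges_to \<theta> m \<mu>" "\<And>i. i \<in> Field \<theta> \<Longrightarrow> Card_order (m i)"
  shows "\<mu> \<le>o |SIGMA i:Field \<theta>. Field (m i)|"
proof (rule ccontr)
  let ?S = "SIGMA i:Field \<theta>. Field (m i)"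
  assume neg: "\<not> \<mu> \<le>o |?S|"
  have le: "|?S| \<le>o \<mu>"
    using neg assms(1) ordLeq_total[of \<mu> "|?S|"] card_of_Well_order
      card_order_on_well_order_on[OF assms(1)] by blast
  then have "|?S| \<le>o |Field \<mu>|"
    using card_of_Field_ordIso[OF assms(1)] ordIso_symmetric ordLeq_ordIso_trans by blast
  then obtain f where f: "inj_on f ?S" "f ` ?S \<subseteq> Field \<mu>"
    using card_of_ordLeq[of ?S "Field \<mu>"] by blast
  have iso: "|?S| =o |f ` ?S|"
    using f(1) card_of_ordIso inj_on_imp_bij_betw by blast
  have "m i \<le>o |f ` ?S|" if i: "i \<in> Field \<theta>" for i
  proof -
    have "|Field (m i)| \<le>o |?S|"
      using card_of_ordLeq[of "Field (m i)" ?S] i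
      by (metis (no_types, lifting) SigmaI image_subsetI inj_on_def prod.inject)
    then show ?thesis
      using iso card_of_Field_ordIso[OF assms(3)[OF i]]
      by (meson ordIso_ordLeq_trans ordIso_symmetric ordLeq_ordIso_trans)
  qed
  then have "\<mu> \<le>o |f ` ?S|"
    using assms(2) card_of_Well_order unfolding converges_to_def by blast
  then show False
    using neg iso ordIso_symmetric ordLeq_ordIso_trans by blast
qed

lemma cofinal_family_ordLess:
  fixes \<mu> :: "'a rel"
  assumes \<theta>: "regular_cardinal \<theta>" and \<mu>: "Card_order \<mu>" and \<theta>\<mu>: "\<theta> <o \<mu>"
    and inc: "increasing_regular_seq \<theta> m" and conv: "converges_to \<theta> m \<mu>"
    and K: "cofinal_in (seq_prod \<theta> m) (less_star \<theta> m) K"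
  shows "\<mu> <o |K|"
proof (rule ccontr)
  assume "\<not> \<mu> <o |K|"
  then have K_le: "|K| \<le>o \<mu>"
    using \<mu> by (meson card_of_Well_order card_order_on_well_order_on not_ordLeq_iff_ordLess)
  have \<theta>c: "Card_order \<theta>" and \<theta>i: "infinite (Field \<theta>)"
    using \<theta> by (auto simp: regular_cardinal_def)
  have \<theta>w: "Well_order \<theta>" using \<theta>c by (simp add: card_order_on_well_order_on)
  have mreg: "regular_cardinal (m i)" if "i \<in> Field \<theta>" for i
    using inc that by (simp add: increasing_regular_seq_def)
  have mc: "Card_order (m i)" and mi: "infinite (Field (m i))" if "i \<in> Field \<theta>" for i
    using mreg[OF that] by (auto simp: regular_cardinal_def)
  let ?S = "SIGMA i:Field \<theta>. Field (m i)"
  have "seq_prod \<theta> m \<noteq> {}"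
    using mi by (fastforce simp: seq_prod_def PiE_eq_empty_iff)
  then have Kne: "K \<noteq> {}" using K by (auto simp: cofinal_in_def)
  have "|K| \<le>o |?S|"
    using K_le converges_to_ordLeq_Sigma[OF \<mu> conv mc] ordLeq_transitive by blast
  \<comment> \<open>The image of \<open>{j}\<close> times \<open>Field (m j)\<close> under
    \<open>p\<close> is the \<open>j\<close>-th piece of \<open>K\<close>, of size at most
    \<open>m j\<close>.\<close>
  then obtain p where p: "p ` ?S = K"
    using card_of_ordLeq2[OF Kne, of ?S] by blast
  \<comment> \<open>If no \<open>m i\<close> exceeded \<open>\<theta>\<close>, a copy of
    \<open>\<theta>\<close> inside \<open>Field \<mu>\<close> would bound them all, giving
    \<open>\<mu> \<le>o \<theta>\<close>.\<close>
  have "\<exists>i\<in>Field \<theta>. \<theta> <o m i"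
  proof (rule ccontr)
    assume "\<not> ?thesis"
    then have le: "m i \<le>o \<theta>" if "i \<in> Field \<theta>" for i
      using that \<theta>w mc by (meson card_order_on_well_order_on not_ordLeq_iff_ordLess)
    have "|Field \<theta>| \<le>o |Field \<mu>|"
      using \<theta>\<mu> \<theta>c \<mu> ordLess_imp_ordLeq by (meson card_of_mono2)
    then obtain f where f: "inj_on f (Field \<theta>)" "f ` Field \<theta> \<subseteq> Field \<mu>"
      using card_of_ordLeq[of "Field \<theta>" "Field \<mu>"] by blast
    have iso: "\<theta> =o |f ` Field \<theta>|"
      using f(1) card_of_ordIso inj_on_imp_bij_betw card_of_Field_ordIso[OF \<theta>c]
      by (meson ordIso_symmetric ordIso_transitive)
    have "\<mu> \<le>o |f ` Field \<theta>|"
      using conv le iso card_of_Well_order ordLeq_ordIso_trans unfolding converges_to_def by blast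
    then have "\<mu> \<le>o \<theta>" using iso ordIso_symmetric ordLeq_ordIso_trans by blast
    then show False using \<theta>\<mu> not_ordLess_ordLeq by blast
  qed
  then obtain i0 where i0: "i0 \<in> Field \<theta>" "\<theta> <o m i0" by blast
  \<comment> \<open>\<open>G i\<close> holds the values at \<open>i\<close> of all members of pieces
    with index strictly below \<open>i\<close>; strictness gives \<open>m j <o m i\<close>, so each
    such piece is small relative to \<open>m i\<close>.\<close>
  define G where "G i = (\<lambda>f. f i) ` (\<Union>j\<in>underS \<theta> i. (\<lambda>x. p (j, x)) ` Field (m j))" for i
  have G_sub: "G i \<subseteq> Field (m i)" if "i \<in> Field \<theta>" for i
  proof -
    have "p (j, x) i \<in> Field (m i)" if "j \<in> Field \<theta>" "x \<in> Field (m j)" for j x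
    proof -
      have "p (j, x) \<in> K" using p that by blast
      then have "p (j, x) \<in> seq_prod \<theta> m" using K unfolding cofinal_in_def by blast
      then show ?thesis using \<open>i \<in> Field \<theta>\<close> by (auto simp: seq_prod_def)
    qed
    then show ?thesis using underS_Field by (fastforce simp: G_def)
  qed
  have bound: "\<exists>b\<in>Field (m i). \<forall>x\<in>G i. (x, b) \<in> m i \<and> x \<noteq> b" if i0i: "(i0, i) \<in> \<theta>" for i
  proof -
    have i: "i \<in> Field \<theta>" using i0i by (auto simp: Field_def)
    have stab: "stable (m i)"
      using mreg[OF i] regularCard_stable by (auto simp: regular_cardinal_def)
    have "m i0 \<le>o m i"
      using inc i0i mc[OF i] i ordLess_imp_ordLeq ordLeq_reflexive card_order_on_well_order_on
      unfolding increasing_regular_seq_def by metis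
    then have "\<theta> <o m i" using i0(2) ordLess_ordLeq_trans by blast
    then have "|underS \<theta> i| <o m i"
      using card_of_underS[OF \<theta>c i] ordLess_transitive by blast
    moreover have "|(\<lambda>x. p (j, x)) ` Field (m j)| <o m i" if "j \<in> underS \<theta> i" for j
    proof -
      have j: "(j, i) \<in> \<theta>" "j \<noteq> i" "j \<in> Field \<theta>" using that by (auto simp: underS_def Field_def)
      then have "m j <o m i" using inc unfolding increasing_regular_seq_def by blast
      then have "|Field (m j)| <o m i"
        using card_of_Field_ordIso[OF mc[OF j(3)]] ordIso_ordLess_trans by blast
      then show ?thesis using card_of_image ordLeq_ordLess_trans by blast
    qed
    ultimately have "|\<Union>j\<in>underS \<theta> i. (\<lambda>x. p (j, x)) ` Field (m j)| <o m i"
      by (rule stable_UNION[OF stab])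
    then have "|G i| <o m i"
      unfolding G_def using card_of_image ordLeq_ordLess_trans by blast
    then show ?thesis
      using regular_cardinal_strict_bound[OF mreg[OF i] G_sub[OF i]] by blast
  qed
  \<comment> \<open>At indices before \<open>i0\<close> an arbitrary element of
    \<open>Field (m i)\<close> serves as the value of \<open>g\<close>.\<close>
  have "\<forall>i\<in>Field \<theta>. \<exists>b\<in>Field (m i). (i0, i) \<in> \<theta> \<longrightarrow> (\<forall>x\<in>G i. (x, b) \<in> m i)"
    using bound mi by (metis ex_in_conv finite.emptyI)
  then obtain g where g: "\<And>i. i \<in> Field \<theta> \<Longrightarrow> g i \<in> Field (m i)"
      "\<And>i x. i \<in> Field \<theta> \<Longrightarrow> (i0, i) \<in> \<theta> \<Longrightarrow> x \<in> G i \<Longrightarrow> (x, g i) \<in> m i"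
    by metis
  have "restrict g (Field \<theta>) \<in> seq_prod \<theta> m"
    using g(1) by (auto simp: seq_prod_def)
  then obtain f where f: "f \<in> K" "less_star \<theta> m (restrict g (Field \<theta>)) f"
    using K unfolding cofinal_in_def by blast
  obtain j x where jx: "j \<in> Field \<theta>" "x \<in> Field (m j)" "f = p (j, x)"
    using f(1) p by blast
  \<comment> \<open>Past the larger of \<open>j\<close> and \<open>i0\<close>, the value
    \<open>f i\<close> belongs to \<open>G i\<close> and is bounded by \<open>g i\<close>, so
    \<open>f\<close> fails to exceed \<open>g\<close> on a whole tail.\<close>
  obtain k where k: "k \<in> Field \<theta>" "(j, k) \<in> \<theta>" "(i0, k) \<in> \<theta>"
    using \<theta>w jx(1) i0(1) unfolding order_on_defs by (metis refl_onD total_on_def)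
  have "(f i, restrict g (Field \<theta>) i) \<in> m i" if i: "i \<in> Field \<theta> - under \<theta> k" for i
  proof -
    have ki: "(k, i) \<in> \<theta>" "k \<noteq> i" using not_under_iff[OF \<theta>w k(1)] i by auto
    have "(j, i) \<in> \<theta>" "(i0, i) \<in> \<theta>" "j \<noteq> i"
      using ki k \<theta>w unfolding order_on_defs by (meson transD antisymD)+
    moreover from this have "f i \<in> G i"
      using jx by (auto simp: G_def underS_def)
    ultimately show ?thesis using g(2) i by simp
  qed
  then have "Field \<theta> - under \<theta> k \<subseteq> {i \<in> Field \<theta>. (f i, restrict g (Field \<theta>) i) \<in> m i}"
    by blast
  then show False
    using not_ordLess_if_cobounded[OF \<theta>c \<theta>i] f(2) unfolding less_star_def by blast
qed

section \<open>The upper bound from \<open>CP\<close>\<close>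

lemma CP_cofinal_family:
  fixes l :: "'l rel"
  assumes cov: "covering_matrix \<theta> l D" and resp: "respects_seq \<theta> l D m" and CP: "CP \<theta> l D"
    and mreg: "\<And>i. i \<in> Field \<theta> \<Longrightarrow> regular_cardinal (m i)"
    and m_le: "\<And>i. i \<in> Field \<theta> \<Longrightarrow> m i \<le>o l"
  shows "\<exists>K. cofinal_in (seq_prod \<theta> m) (less_star \<theta> m) K \<and> |K| \<le>o l"
proof -
  have \<theta>: "regular_cardinal \<theta>" and l: "regular_cardinal l" and \<theta>l: "\<theta> <o l"
    and chain: "\<And>\<beta>. \<beta> \<in> Field l \<Longrightarrow> relChain \<theta> (\<lambda>i. D i \<beta>)"
    using cov by (auto simp: covering_matrix_def)
  have \<theta>c: "Card_order \<theta>" and \<theta>i: "infinite (Field \<theta>)" and lc: "Card_order l"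
    using \<theta> l by (auto simp: regular_cardinal_def)
  have \<theta>w: "Well_order \<theta>" using \<theta>c by (simp add: card_order_on_well_order_on)
  obtain A where A: "A \<subseteq> Field l" "cofinal A l"
    and ACP: "\<forall>X. X \<subseteq> A \<and> |X| =o \<theta> \<longrightarrow> (\<exists>\<beta>\<in>Field l. \<exists>i\<in>Field \<theta>. X \<subseteq> D i \<beta>)"
    using CP unfolding CP_def by blast
  \<comment> \<open>By regularity of \<open>l\<close> the unbounded set \<open>A\<close> has full
    size, which leaves room for injections of every \<open>m i\<close> and of
    \<open>\<theta>\<close>.\<close>
  have Al: "|A| =o l"
    using A l unfolding regular_cardinal_def regularCard_def by blast
  have "\<exists>e. inj_on e (Field (m i)) \<and> e ` Field (m i) \<subseteq> A" if i: "i \<in> Field \<theta>" for i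
  proof -
    have "Card_order (m i)" using mreg[OF i] by (simp add: regular_cardinal_def)
    then have "|Field (m i)| \<le>o |A|"
      using m_le[OF i] Al card_of_Field_ordIso
      by (meson ordIso_ordLeq_trans ordIso_symmetric ordLeq_ordIso_trans)
    then show ?thesis using card_of_ordLeq[of "Field (m i)" A] by blast
  qed
  then obtain e where e: "\<And>i. i \<in> Field \<theta> \<Longrightarrow> inj_on (e i) (Field (m i))"
      "\<And>i. i \<in> Field \<theta> \<Longrightarrow> e i ` Field (m i) \<subseteq> A"
    by metis
  have "\<theta> \<le>o |A|"
    using \<theta>l Al ordLess_imp_ordLeq ordIso_symmetric ordLeq_ordIso_trans by blast
  then have "|Field \<theta>| \<le>o |A|"
    using card_of_Field_ordIso[OF \<theta>c] ordIso_ordLeq_trans by blast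
  \<comment> \<open>\<open>CP\<close> speaks of sets of size exactly \<open>\<theta>\<close>, while
    the coded values of a function may repeat. The image of \<open>h\<close> pads such a set to the
    right size.\<close>
  then obtain h where h: "inj_on h (Field \<theta>)" "h ` Field \<theta> \<subseteq> A"
    using card_of_ordLeq[of "Field \<theta>" A] by blast
  \<comment> \<open>Since \<open>e i\<close> is injective, the ordinals coded in
    \<open>D i \<beta>\<close> are no more numerous than \<open>D i \<beta>\<close> itself, hence
    fewer than \<open>m i\<close>.\<close>
  define S where "S i \<beta> = {x \<in> Field (m i). e i x \<in> D i \<beta>}" for i \<beta>
  have "\<exists>b\<in>Field (m i). \<forall>x\<in>S i \<beta>. (x, b) \<in> m i \<and> x \<noteq> b"
    if i: "i \<in> Field \<theta>" and \<beta>: "\<beta> \<in> Field l" for i \<beta>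
  proof -
    have "inj_on (e i) (S i \<beta>)" "e i ` S i \<beta> \<subseteq> D i \<beta>"
      using e(1)[OF i] by (auto simp: S_def inj_on_def)
    then have "|S i \<beta>| \<le>o |D i \<beta>|" using card_of_ordLeq[of "S i \<beta>" "D i \<beta>"] by blast
    moreover have "|D i \<beta>| <o m i" using resp i \<beta> by (simp add: respects_seq_def)
    ultimately have "|S i \<beta>| <o m i" using ordLeq_ordLess_trans by blast
    then show ?thesis
      using regular_cardinal_strict_bound[OF mreg[OF i], of "S i \<beta>"] by (auto simp: S_def)
  qed
  then obtain g where g: "\<And>i \<beta>. i \<in> Field \<theta> \<Longrightarrow> \<beta> \<in> Field l \<Longrightarrow> g i \<beta> \<in> Field (m i)"
      "\<And>i \<beta> x. i \<in> Field \<theta> \<Longrightarrow> \<beta> \<in> Field l \<Longrightarrow> x \<in> S i \<beta> \<Longrightarrow> (x, g i \<beta>) \<in> m i \<and> x \<noteq> g i \<beta>"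
    by metis
  define K where "K = (\<lambda>\<beta>. \<lambda>i\<in>Field \<theta>. g i \<beta>) ` Field l"
  have "K \<subseteq> seq_prod \<theta> m"
    using g(1) by (auto simp: K_def seq_prod_def)
  moreover have "\<exists>y\<in>K. less_star \<theta> m f y" if f: "f \<in> seq_prod \<theta> m" for f
  proof -
    have fF: "f i \<in> Field (m i)" if "i \<in> Field \<theta>" for i
      using f that by (auto simp: seq_prod_def)
    define X where "X = (\<lambda>i. e i (f i)) ` Field \<theta> \<union> h ` Field \<theta>"
    have "X \<subseteq> A" using e(2) fF h(2) by (fastforce simp: X_def)
    moreover have "|X| =o \<theta>"
    proof -
      have "|X| \<le>o |Field \<theta>|"
        unfolding X_def using \<theta>i
        by (intro card_of_Un_ordLeq_infinite_Field card_of_image card_of_Card_order)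
          (simp add: Field_card_of)
      moreover have "|Field \<theta>| \<le>o |X|"
        using h(1) card_of_ordLeq[of "Field \<theta>" X] by (auto simp: X_def)
      ultimately show ?thesis
        using card_of_Field_ordIso[OF \<theta>c] by (meson ordIso_iff_ordLeq ordIso_transitive)
    qed
    ultimately obtain \<beta> i where \<beta>: "\<beta> \<in> Field l" and i: "i \<in> Field \<theta>" and X: "X \<subseteq> D i \<beta>"
      using ACP by blast
    let ?y = "\<lambda>i\<in>Field \<theta>. g i \<beta>"
    \<comment> \<open>From \<open>i\<close> on, the chain condition puts the code of
      \<open>f j\<close> into \<open>D j \<beta>\<close>, so \<open>f j\<close> lies strictly below
      \<open>g j \<beta>\<close>. The exceptional indices thus fill only part of an initial segment
      of \<open>\<theta>\<close>.\<close>
    have "j \<in> under \<theta> i" if j: "j \<in> Field \<theta>" "(?y j, f j) \<in> m j" for j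
    proof (rule ccontr)
      assume "j \<notin> under \<theta> i"
      then have "(i, j) \<in> \<theta>" using not_under_iff[OF \<theta>w i j(1)] by blast
      then have "D i \<beta> \<subseteq> D j \<beta>" using chain[OF \<beta>] by (simp add: relChain_def)
      then have "f j \<in> S j \<beta>" using X j(1) fF by (auto simp: S_def X_def)
      then have "(f j, g j \<beta>) \<in> m j" "f j \<noteq> g j \<beta>" using g(2)[OF j(1) \<beta>] by auto
      moreover have "antisym (m j)"
        using mreg[OF j(1)] card_order_on_well_order_on[of _ "m j"]
        unfolding regular_cardinal_def order_on_defs by blast
      ultimately show False using j by (auto dest: antisymD)
    qed
    then have "{j \<in> Field \<theta>. (?y j, f j) \<in> m j} \<subseteq> under \<theta> i" by blast
    then have "less_star \<theta> m f ?y"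
      unfolding less_star_def
      using card_of_mono1 under_ordLess[OF \<theta>c \<theta>i] ordLeq_ordLess_trans by blast
    then show ?thesis using \<beta> by (auto simp: K_def)
  qed
  moreover have "|K| \<le>o l"
    unfolding K_def using card_of_image card_of_Field_ordIso[OF lc] ordLeq_ordIso_trans by blast
  ultimately show ?thesis by (auto simp: cofinal_in_def)
qed

section \<open>Combination of the two bounds\<close>

theorem theorem4p17:
  fixes \<mu> :: "'a rel"
    and \<theta> :: "'t rel"
    and m :: "'t \<Rightarrow> 'a rel"
  assumes "singular_cardinal \<mu>"
    and "is_cf_of_cardinal \<mu> \<theta>"
    and "increasing_regular_seq \<theta> m"
    and "converges_to \<theta> m \<mu>"
    and "\<exists>D :: 't \<Rightarrow> 'a set \<Rightarrow> 'a set set.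
           covering_matrix \<theta> (cardSuc \<mu>) D \<and>
           respects_seq \<theta> (cardSuc \<mu>) D m \<and>
           CP \<theta> (cardSuc \<mu>) D"
  shows "is_cf (seq_prod \<theta> m) (less_star \<theta> m) (cardSuc \<mu>)"
proof -
  obtain D :: "'t \<Rightarrow> 'a set \<Rightarrow> 'a set set"
    where D: "covering_matrix \<theta> (cardSuc \<mu>) D" "respects_seq \<theta> (cardSuc \<mu>) D m"
      "CP \<theta> (cardSuc \<mu>) D"
    using assms(5) by blast
  have \<mu>: "Card_order \<mu>" and \<mu>s: "\<not> regularCard \<mu>"
    using assms(1) by (auto simp: singular_cardinal_def)
  have \<theta>: "regular_cardinal \<theta>" and "\<theta> <o cardSuc \<mu>"
    using D(1) by (auto simp: covering_matrix_def)
  have \<theta>c: "Card_order \<theta>" using \<theta> by (simp add: regular_cardinal_def)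
  have "\<theta> \<le>o \<mu>"
    using \<open>\<theta> <o cardSuc \<mu>\<close> cardSuc_ordLeq_ordLess[OF \<mu> \<theta>c] by blast
  \<comment> \<open>The index cardinal of the covering matrix is regular, whereas
    \<open>\<mu>\<close> is singular.\<close>
  moreover have "\<not> \<theta> =o \<mu>"
    using regularCard_ordIso[of \<theta> \<mu>] \<theta> \<mu>s by (auto simp: regular_cardinal_def cinfinite_def)
  ultimately have \<theta>\<mu>: "\<theta> <o \<mu>" using ordLeq_iff_ordLess_or_ordIso by blast
  have lower: "cardSuc \<mu> \<le>o |K|" if "cofinal_in (seq_prod \<theta> m) (less_star \<theta> m) K" for K
    using cofinal_family_ordLess[OF \<theta> \<mu> \<theta>\<mu> assms(3,4) that] \<mu> card_of_Card_order
    by (blast intro: cardSuc_least)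
  have "regular_cardinal (m i)" "m i \<le>o cardSuc \<mu>" if "i \<in> Field \<theta>" for i
    using assms(3,4) that cardSuc_ordLeq[OF \<mu>] ordLeq_transitive
    unfolding increasing_regular_seq_def converges_to_def by blast+
  then obtain K where K: "cofinal_in (seq_prod \<theta> m) (less_star \<theta> m) K" "|K| \<le>o cardSuc \<mu>"
    using CP_cofinal_family[OF D] by blast
  then have "|K| =o cardSuc \<mu>" using lower by (simp add: ordIso_iff_ordLeq)
  then show ?thesis
    using K(1) lower \<mu> unfolding is_cf_def by (blast intro: cardSuc_Card_order)
qed

end
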